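(* Let $\mathcal{A}=\mathcal{A}_1\times\cdots\times\mathcal{A}_d\subseteq\mathbb{R}^d$, where each $\mathcal{A}_i\subseteq\mathbb{R}$ is a nonempty finite set, and let $f:\mathbb{R}^d\to\mathbb{R}$ be such that: (i) $-\infty<f_{\min}:=\min_{a\in\mathcal{A}}f(a)$; (ii) $f$ is differentiable and its gradient is $L_f$-Lipschitz on $\mathbb{R}^d$; (iii) for some constant $\mu\ge 0$, the function $x\mapsto f(x)+\frac{\mu}{2}\|x\|^2$ is convex. Let $\sigma(\rho):=\rho-\mu$ and let $\rho>0$ satisfy $\rho^{-1}L_f^2-\frac{\sigma(\rho)}{2}<0$. Let $(x^r,y^r,\lambda^r)_{r\ge0}$ be generated by the ADMM-R algorithm with parameter $\rho$. Then, with probability one, for every limit point $(\bar x,\bar y,\bar\lambda)$ of the iterates, $\bar x$ is a $\rho$-stationary point of the problem $\min_{x\in\mathcal{A}}f(x)$.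
   Context: Norms are Euclidean. For a nonempty finite set $\mathcal{A}$, the projection $\mathcal{P}_{\mathcal{A}}(x)$ is an element of $\arg\min_{a\in\mathcal{A}}\|x-a\|^2$; if this set has several elements, the lexicographically smallest one is chosen. Let $\mathcal{I}_{\mathcal{A}}(y)=0$ if $y\in\mathcal{A}$ and $+\infty$ otherwise. The augmented Lagrangian is $\mathcal{L}(x,y,\lambda)=f(x)+\mathcal{I}_{\mathcal{A}}(y)+\langle\lambda,x-y\rangle+\frac{\rho}{2}\|x-y\|^2$. ADMM-R algorithm (parameter $\rho>0$, and numbers $p_i^r\in[\alpha,1]$, $1\le i\le d$, $r\ge 0$, for some constant $\alpha>0$): start from $x^0=y^0\in\mathcal{A}$ and arbitrary $\lambda^0\in\mathbb{R}^d$; for $r=0,1,2,\dots$: draw afresh (independently of the draws made at other iterations) a random vector $m^r=(m_1^r,\dots,m_d^r)$ of Bernoulli ($\{0,1\}$-valued) random variables with $\mathrm{Prob}(m_i^r=1)=p_i^r$, the coordinates $m_1^r,\dots,m_d^r$ being possibly correlated with each other; compute $\hat y^{r+1}=\mathcal{P}_{\mathcal{A}}(x^r+\rho^{-1}\lambda^r)$; set $y_i^{r+1}=m_i^r\hat y_i^{r+1}+(1-m_i^r)y_i^r$ for $i=1,\dots,d$; set $x^{r+1}=\arg\min_x\mathcal{L}(x,y^{r+1},\lambda^r)$; set $\lambda^{r+1}=\lambda^r+\rho(x^{r+1}-y^{r+1})$. A point $\bar x$ is a $\rho$-stationary point of $\min_{x\in\mathcal{A}}f(x)$ if $\bar x\in\arg\min_{a\in\mathcal{A}}\|a-(\bar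 x-\rho^{-1}\nabla f(\bar x))\|$. *)

theory Defs
  imports "HOL-Probability.Probability" "HOL-Library.Fun_Lexorder"
begin

definition gradient :: "('a::real_inner \<Rightarrow> real) \<Rightarrow> 'a \<Rightarrow> 'a" where
  "gradient f x = (THE D. GDERIV f x :> D)"

definition nearest_points :: "(real ^ 'n) set \<Rightarrow> real ^ 'n \<Rightarrow> (real ^ 'n) set" where
  "nearest_points A x = {a. is_arg_min (\<lambda>a. (norm (x - a))\<^sup>2) (\<lambda>a. a \<in> A) a}"

text \<open>
  The index type carries a linear order, which only serves to make sense of the
  lexicographic tie-breaking rule; \<^const>\<open>less_fun\<close> is the strict lexicographic order
  on functions, applied here to the coordinate functions of the vectors.
\<close>

definition projection :: "((real, 'n::{finite, linorder}) vec) set \<Rightarrow> (real, 'n) vec \<Rightarrow> (real, 'n) vec" where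
  "projection A x =
     (THE a. a \<in> nearest_points A x \<and>
        (\<forall>b \<in> nearest_points A x. b \<noteq> a \<longrightarrow> less_fun (\<lambda>i. a $ i) (\<lambda>i. b $ i)))"

definition set_indicator :: "'a set \<Rightarrow> 'a \<Rightarrow> ereal" where
  "set_indicator A y = (if y \<in> A then 0 else \<infinity>)"

definition aug_lagrangian ::
  "('a::real_inner \<Rightarrow> real) \<Rightarrow> 'a set \<Rightarrow> real \<Rightarrow> 'a \<Rightarrow> 'a \<Rightarrow> 'a \<Rightarrow> ereal" where
  "aug_lagrangian f A \<rho> x y l =
     ereal (f x) + set_indicator A y + ereal (l \<bullet> (x - y))
       + ereal (\<rho> / 2 * (norm (x - y))\<^sup>2)"

text \<open>
  A run of ADMM-R for one realisation \<open>m\<close> of the random masks, started at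
  \<open>x 0 = y 0 = x0\<close> and \<open>l 0 = l0\<close>; \<open>l\<close> is the sequence of multipliers.
\<close>

definition admm_r_run ::
  "((real, 'n::{finite, linorder}) vec \<Rightarrow> real) \<Rightarrow> (real, 'n) vec set \<Rightarrow> real \<Rightarrow> (real, 'n) vec \<Rightarrow> (real, 'n) vec \<Rightarrow>
   (nat \<Rightarrow> (real, 'n) vec) \<Rightarrow>
   (nat \<Rightarrow> (real, 'n) vec) \<Rightarrow> (nat \<Rightarrow> (real, 'n) vec) \<Rightarrow> (nat \<Rightarrow> (real, 'n) vec) \<Rightarrow> bool" where
  "admm_r_run f A \<rho> x0 l0 m x y l \<longleftrightarrow>
     x0 \<in> A \<and> x 0 = x0 \<and> y 0 = x0 \<and> l 0 = l0 \<and>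
     (\<forall>r. (\<forall>i. y (Suc r) $ i =
               m r $ i * projection A (x r + inverse \<rho> *\<^sub>R l r) $ i + (1 - m r $ i) * y r $ i) \<and>
          is_arg_min (\<lambda>z. aug_lagrangian f A \<rho> z (y (Suc r)) (l r)) (\<lambda>_. True) (x (Suc r)) \<and>
          l (Suc r) = l r + \<rho> *\<^sub>R (x (Suc r) - y (Suc r)))"

definition rho_stationary ::
  "real \<Rightarrow> ('a::real_inner \<Rightarrow> real) \<Rightarrow> 'a set \<Rightarrow> 'a \<Rightarrow> bool" where
  "rho_stationary \<rho> f A x \<longleftrightarrow>
     is_arg_min (\<lambda>a. norm (a - (x - inverse \<rho> *\<^sub>R gradient f x))) (\<lambda>a. a \<in> A) x"

definition seq_limit_point :: "(nat \<Rightarrow> 'a::topological_space) \<Rightarrow> 'a \<Rightarrow> bool" where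
  "seq_limit_point X z \<longleftrightarrow> (\<exists>s::nat \<Rightarrow> nat. strict_mono s \<and> (X \<circ> s) \<longlonglongrightarrow> z)"

end

theory Submission
  imports Defs
begin

text \<open>
  Optimality of the \<open>x\<close>-step gives \<open>\<lambda> = - \<nabla>f(x)\<close> after one iteration, so the ascent caused by the
  multiplier update is at most \<open>L\<^sub>f\<^sup>2 / \<rho>\<close> times the squared \<open>x\<close>-increment, which the strong
  convexity of the \<open>x\<close>-subproblem outweighs.  Since \<open>A\<close> is a product, replacing only some
  coordinates of \<open>y\<close> by those of the projection stays in \<open>A\<close> and never increases the Lagrangian.
  Hence for every realisation of the masks the Lagrangian decreases, it is bounded below because
  \<open>L\<^sub>f \<le> \<rho>\<close>, and the increments of \<open>x\<close> and the gaps \<open>x - y\<close> tend to \<open>0\<close>; as \<open>A\<close> is finite, \<open>y\<close> is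
  eventually a constant \<open>c\<close>, to which \<open>x\<close> converges.  Randomness enters only at the end: almost
  surely every coordinate is refreshed infinitely often, each late refresh of coordinate \<open>i\<close>
  exhibits \<open>c\<^sub>i\<close> as a nearest point of \<open>A\<^sub>i\<close>, and this passes to the limit.
\<close>

section \<open>Gradients, smoothness and convexity\<close>

lemma GDERIV_unique:
  assumes "GDERIV f x :> D" "GDERIV f x :> E"
  shows "D = E"
proof -
  have "(\<lambda>h. h \<bullet> D) = (\<lambda>h. h \<bullet> E)"
    using assms has_derivative_unique unfolding gderiv_def by blast
  then show ?thesis
    by (metis inner_commute inner_eq_zero_iff inner_diff_right right_minus_eq)
qed

text \<open>Makes the description in \<open>gradient\<close> usable: the adjoint of the derivative,
  applied to 1, is its Riesz representative.\<close>

lemma GDERIV_gradient: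
  fixes f :: "'a::euclidean_space \<Rightarrow> real"
  assumes "f differentiable (at x)"
  shows "GDERIV f x :> gradient f x"
proof -
  obtain f' where f': "(f has_derivative f') (at x)"
    using assms unfolding differentiable_def by blast
  then interpret bounded_linear f'
    by (rule has_derivative_bounded_linear)
  have "f' h = h \<bullet> adjoint f' 1" for h
    using adjoint_works[OF linear_axioms, of h 1] by simp
  then have "f' = (\<lambda>h. h \<bullet> adjoint f' 1)"
    by auto
  with f' have D: "GDERIV f x :> adjoint f' 1"
    unfolding gderiv_def by simp
  show ?thesis
    unfolding gradient_def by (rule theI[where P = "gderiv f x", OF D GDERIV_unique[OF _ D]])
qed

text \<open>The descent lemma: along the segment from \<open>x\<close> to \<open>y\<close>, the
  excess of \<open>f\<close> over its quadratic model has nonpositive derivative, by Cauchy-Schwarz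
  and the Lipschitz bound.\<close>

lemma lipschitz_gradient_upper_bound:
  fixes f :: "'a::real_inner \<Rightarrow> real"
  assumes deriv: "\<And>z. GDERIV f z :> g z"
    and lip: "L-lipschitz_on UNIV g"
  shows "f y \<le> f x + g x \<bullet> (y - x) + L / 2 * (norm (y - x))\<^sup>2"
proof -
  define d where "d = y - x"
  define \<phi> where "\<phi> t = f (x + t *\<^sub>R d) - t * (g x \<bullet> d) - L / 2 * t\<^sup>2 * (norm d)\<^sup>2" for t
  have "\<phi> 0 \<ge> \<phi> 1"
  proof (rule DERIV_nonpos_imp_nonincreasing[OF zero_le_one])
    fix t :: real
    assume t: "0 \<le> t" "t \<le> 1"
    \<comment> \<open>This is the derivative of \<open>\<phi>\<close> at \<open>t\<close>.\<close>
    define e where "e = (g (x + t *\<^sub>R d) - g x) \<bullet> d - L * t * (norm d)\<^sup>2"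
    have fd: "(f has_derivative (\<lambda>h. h \<bullet> g (x + t *\<^sub>R d))) (at (x + t *\<^sub>R d))"
      using deriv by (simp add: gderiv_def)
    have "((\<lambda>t. f (x + t *\<^sub>R d)) has_derivative (\<lambda>h. (h *\<^sub>R d) \<bullet> g (x + t *\<^sub>R d))) (at t)"
      by (rule has_derivative_compose[where f = "\<lambda>t. x + t *\<^sub>R d" and g = f, OF _ fd]) (auto intro!: derivative_eq_intros)
    then have "((\<lambda>t. f (x + t *\<^sub>R d)) has_field_derivative (g (x + t *\<^sub>R d) \<bullet> d)) (at t)"
      unfolding has_field_derivative_def
      by (rule has_derivative_eq_rhs) (auto simp: inner_commute mult.commute)
    then have "(\<phi> has_field_derivative e) (at t)"
      unfolding \<phi>_def e_def
      by (auto intro!: derivative_eq_intros simp: inner_diff_left)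
    moreover have "e \<le> 0"
    proof -
      have "(g (x + t *\<^sub>R d) - g x) \<bullet> d \<le> norm (g (x + t *\<^sub>R d) - g x) * norm d"
        by (rule norm_cauchy_schwarz)
      also have "\<dots> \<le> (L * norm (t *\<^sub>R d)) * norm d"
        using lipschitz_onD[OF lip, of "x + t *\<^sub>R d" x]
        by (intro mult_right_mono) (auto simp: dist_norm)
      finally show ?thesis
        using t by (simp add: e_def power2_eq_square mult.assoc)
    qed
    ultimately show "\<exists>y. DERIV \<phi> t :> y \<and> y \<le> 0"
      by blast
  qed
  then show ?thesis
    by (simp add: \<phi>_def d_def)
qed

text \<open>Quadratic growth without derivatives: compare the minimum with points of the segment
  from \<open>u\<close> to \<open>z\<close>, divide by the step \<open>t\<close>, and let
  \<open>t\<close> tend to 0.\<close>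

lemma strongly_convex_growth_at_minimum:
  fixes g :: "'a::real_inner \<Rightarrow> real"
  assumes conv: "convex_on UNIV (\<lambda>z. g z - s / 2 * (norm z)\<^sup>2)"
    and min: "\<And>z. g u \<le> g z"
  shows "g u + s / 2 * (norm (z - u))\<^sup>2 \<le> g z"
proof -
  \<comment> \<open>The squared norm satisfies the strong convexity inequality with equality; its
    defect is the growth term.\<close>
  have split: "(norm ((1 - t) *\<^sub>R u + t *\<^sub>R z))\<^sup>2 + t * (1 - t) * (norm (z - u))\<^sup>2
      = (1 - t) * (norm u)\<^sup>2 + t * (norm z)\<^sup>2" for t
    by (simp add: power2_norm_eq_inner inner_simps algebra_simps inner_commute)
  have *: "s / 2 * (1 - t) * (norm (z - u))\<^sup>2 \<le> g z - g u" if t: "0 < t" "t < 1" for t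
  proof -
    have "g u - s / 2 * (norm ((1 - t) *\<^sub>R u + t *\<^sub>R z))\<^sup>2
        \<le> g ((1 - t) *\<^sub>R u + t *\<^sub>R z) - s / 2 * (norm ((1 - t) *\<^sub>R u + t *\<^sub>R z))\<^sup>2"
      using min by simp
    also have "\<dots> \<le> (1 - t) * (g u - s / 2 * (norm u)\<^sup>2) + t * (g z - s / 2 * (norm z)\<^sup>2)"
      using convex_onD[OF conv, of t u z] t by simp
    also have "\<dots> = (1 - t) * g u + t * g z
        - s / 2 * ((norm ((1 - t) *\<^sub>R u + t *\<^sub>R z))\<^sup>2 + t * (1 - t) * (norm (z - u))\<^sup>2)"
      unfolding split by (simp add: field_simps)
    finally have "g u \<le> (1 - t) * g u + t * g z - s / 2 * (t * (1 - t) * (norm (z - u))\<^sup>2)"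
      by (simp only: distrib_left)
    moreover have "s / 2 * (t * (1 - t) * (norm (z - u))\<^sup>2) = t * (s / 2 * (1 - t) * (norm (z - u))\<^sup>2)"
      by simp
    ultimately have "t * (s / 2 * (1 - t) * (norm (z - u))\<^sup>2) \<le> t * (g z - g u)"
      by (simp add: left_diff_distrib right_diff_distrib)
    then show ?thesis
      using t by simp
  qed
  have "((\<lambda>t. s / 2 * (1 - t) * (norm (z - u))\<^sup>2) \<longlongrightarrow> s / 2 * (1 - 0) * (norm (z - u))\<^sup>2)
    (at_right 0)"
    by (intro tendsto_intros)
  moreover have "\<forall>\<^sub>F t in at_right 0. s / 2 * (1 - t) * (norm (z - u))\<^sup>2 \<le> g z - g u"
    unfolding eventually_at_right[OF zero_less_one] using * by (intro exI[of _ 1]) auto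
  ultimately have "s / 2 * (1 - 0) * (norm (z - u))\<^sup>2 \<le> g z - g u"
    using tendsto_upperbound trivial_limit_at_right_real by blast
  then show ?thesis
    by simp
qed

lemma convex_on_inner_add_const:
  fixes w :: "'a::real_inner"
  shows "convex_on UNIV (\<lambda>z. w \<bullet> z + k)"
  unfolding convex_on_def
proof (intro conjI convex_UNIV ballI allI impI)
  fix a b :: 'a and u v :: real
  assume "u + v = 1"
  then have "w \<bullet> (u *\<^sub>R a + v *\<^sub>R b) + k = u * (w \<bullet> a) + v * (w \<bullet> b) + (u + v) * k"
    by (simp add: inner_add_right)
  also have "\<dots> = u * (w \<bullet> a + k) + v * (w \<bullet> b + k)"
    by (simp add: algebra_simps)
  finally show "w \<bullet> (u *\<^sub>R a + v *\<^sub>R b) + k \<le> u * (w \<bullet> a + k) + v * (w \<bullet> b + k)"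
    by simp
qed

section \<open>Projection onto finite product sets\<close>

lemma finite_vec_box:
  fixes As :: "'n::finite \<Rightarrow> 'a set"
  assumes "\<And>i. finite (As i)"
  shows "finite {a :: ('a, 'n) vec. \<forall>i. a $ i \<in> As i}"
proof -
  have "{a :: ('a, 'n) vec. \<forall>i. a $ i \<in> As i} \<subseteq> vec_lambda ` (Pi\<^sub>E UNIV As)"
    by (auto intro!: image_eqI[where x = "vec_nth _"])
  moreover have "finite (Pi\<^sub>E UNIV As)"
    using assms by (intro finite_PiE) auto
  ultimately show ?thesis
    using finite_subset by blast
qed

lemma ex_lexicographic_least:
  fixes S :: "(real, 'n::{finite, linorder}) vec set"
  assumes "finite S" "S \<noteq> {}"
  shows "\<exists>a\<in>S. \<forall>b\<in>S. b \<noteq> a \<longrightarrow> less_fun (\<lambda>i. a $ i) (\<lambda>i. b $ i)"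
  using assms
proof (induction S rule: finite_ne_induct)
  case (singleton a)
  then show ?case by simp
next
  case (insert c S)
  then obtain a where a: "a \<in> S" "\<And>b. b \<in> S \<Longrightarrow> b \<noteq> a \<Longrightarrow> less_fun (\<lambda>i. a $ i) (\<lambda>i. b $ i)"
    by blast
  have "less_fun (\<lambda>i. a $ i) (\<lambda>i. c $ i) \<or> (\<lambda>i. a $ i) = (\<lambda>i. c $ i)
      \<or> less_fun (\<lambda>i. c $ i) (\<lambda>i. a $ i)"
    by (rule less_fun_trichotomy) simp
  moreover have "a \<noteq> c"
    using a insert by blast
  ultimately consider "less_fun (\<lambda>i. a $ i) (\<lambda>i. c $ i)" | "less_fun (\<lambda>i. c $ i) (\<lambda>i. a $ i)"
    by (metis vec_nth_inject)
  then show ?case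
  proof cases
    case 1
    then show ?thesis using a by auto
  next
    case 2
    then have "less_fun (\<lambda>i. c $ i) (\<lambda>i. b $ i)" if "b \<in> S" for b
      using that a less_fun_trans by (cases "b = a") blast+
    then show ?thesis by auto
  qed
qed

text \<open>The description in \<open>projection\<close> denotes: the finite nonempty set of nearest
  points has a lexicographically least element, and asymmetry of the order makes it unique.\<close>

lemma projection_in_nearest_points:
  fixes A :: "(real, 'n::{finite, linorder}) vec set"
  assumes "finite A" "A \<noteq> {}"
  shows "projection A x \<in> nearest_points A x"
proof -
  let ?N = "nearest_points A x"
  have "\<exists>a\<in>A. \<forall>b\<in>A. (norm (x - a))\<^sup>2 \<le> (norm (x - b))\<^sup>2"
    using ex_is_arg_min_if_finite[OF assms, of "\<lambda>a. (norm (x - a))\<^sup>2"]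
    by (auto simp: is_arg_min_linorder)
  then have N_ne: "?N \<noteq> {}"
    by (auto simp: nearest_points_def is_arg_min_linorder)
  have N_fin: "finite ?N"
    by (rule finite_subset[OF _ assms(1)]) (auto simp: nearest_points_def is_arg_min_linorder)
  obtain a where a: "a \<in> ?N" "\<forall>b\<in>?N. b \<noteq> a \<longrightarrow> less_fun (\<lambda>i. a $ i) (\<lambda>i. b $ i)"
    using ex_lexicographic_least[OF N_fin N_ne] by (rule bexE)
  have "projection A x = a"
    unfolding projection_def
  proof (rule the_equality)
    fix a'
    assume a': "a' \<in> ?N \<and> (\<forall>b\<in>?N. b \<noteq> a' \<longrightarrow> less_fun (\<lambda>i. a' $ i) (\<lambda>i. b $ i))"
    show "a' = a"
    proof (rule ccontr)
      assume "a' \<noteq> a"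
      then have "less_fun (\<lambda>i. a $ i) (\<lambda>i. a' $ i)" "less_fun (\<lambda>i. a' $ i) (\<lambda>i. a $ i)"
        using a a' by auto
      then show False
        using less_fun_asym by auto
    qed
  qed (use a in auto)
  then show ?thesis
    using a(1) by simp
qed

lemma norm_vec_sq: "(norm v)\<^sup>2 = (\<Sum>i\<in>UNIV. (v $ i)\<^sup>2)" for v :: "(real, 'n::finite) vec"
  unfolding power2_norm_eq_inner inner_vec_def by (simp add: power2_eq_square)

text \<open>The squared distance is separable and \<open>A\<close> is a product, so minimality can
  be tested by changing coordinate \<open>i\<close> alone.\<close>

lemma nearest_points_box_component:
  fixes As :: "'n::finite \<Rightarrow> real set"
  assumes A: "A = {a. \<forall>i. a $ i \<in> As i}"
    and a: "a \<in> nearest_points A x"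
    and c: "c \<in> As i"
  shows "(x $ i - a $ i)\<^sup>2 \<le> (x $ i - c)\<^sup>2"
proof -
  have a': "\<And>j. a $ j \<in> As j"
    and min: "\<And>b. \<forall>j. b $ j \<in> As j \<Longrightarrow> (norm (x - a))\<^sup>2 \<le> (norm (x - b))\<^sup>2"
    using a by (auto simp: A nearest_points_def is_arg_min_linorder)
  define b where "b = (\<chi> j. if j = i then c else a $ j)"
  have "(\<Sum>j\<in>UNIV. (x $ j - a $ j)\<^sup>2) \<le> (\<Sum>j\<in>UNIV. (x $ j - b $ j)\<^sup>2)"
    using min[of b] a' c by (simp add: norm_vec_sq b_def)
  moreover have "(\<Sum>j\<in>UNIV - {i}. (x $ j - a $ j)\<^sup>2) = (\<Sum>j\<in>UNIV - {i}. (x $ j - b $ j)\<^sup>2)"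
    by (rule sum.cong) (auto simp: b_def)
  ultimately have "(x $ i - a $ i)\<^sup>2 \<le> (x $ i - b $ i)\<^sup>2"
    by (simp add: sum.remove[of UNIV i])
  then show "(x $ i - a $ i)\<^sup>2 \<le> (x $ i - c)\<^sup>2"
    by (simp add: b_def)
qed

section \<open>The finite part of the augmented Lagrangian\<close>

definition lagrangian :: "('a::real_inner \<Rightarrow> real) \<Rightarrow> real \<Rightarrow> 'a \<Rightarrow> 'a \<Rightarrow> 'a \<Rightarrow> real" where
  "lagrangian f \<rho> x y l = f x + l \<bullet> (x - y) + \<rho> / 2 * (norm (x - y))\<^sup>2"

lemma aug_lagrangian_eq:
  "y \<in> A \<Longrightarrow> aug_lagrangian f A \<rho> x y l = ereal (lagrangian f \<rho> x y l)"
  by (simp add: aug_lagrangian_def lagrangian_def set_indicator_def)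

text \<open>For fixed \<open>x\<close> and \<open>l\<close>, the variable \<open>y\<close> enters
  only through its distance to \<open>x + inverse \<rho> *\<^sub>R l\<close>, the point that the
  algorithm projects.\<close>

lemma lagrangian_completed_square:
  assumes "\<rho> \<noteq> 0"
  shows "lagrangian f \<rho> x y l
    = f x + \<rho> / 2 * (norm (x + inverse \<rho> *\<^sub>R l - y))\<^sup>2 - (norm l)\<^sup>2 / (2 * \<rho>)"
proof -
  have "(norm (x + inverse \<rho> *\<^sub>R l - y))\<^sup>2 = (norm ((x - y) + inverse \<rho> *\<^sub>R l))\<^sup>2"
    by (simp add: algebra_simps)
  also have "\<dots> = (norm (x - y))\<^sup>2 + 2 * inverse \<rho> * (l \<bullet> (x - y)) + (inverse \<rho>)\<^sup>2 * (norm l)\<^sup>2"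
    unfolding power2_norm_eq_inner inner_add_left inner_add_right
    by (simp add: inner_commute power2_eq_square)
  finally show ?thesis
    using assms by (simp add: lagrangian_def field_simps power2_eq_square)
qed

section \<open>Deterministic analysis of one run with fixed masks\<close>

locale admm_r =
  fixes As :: "'n::{finite, linorder} \<Rightarrow> real set"
    and A :: "(real, 'n) vec set"
    and f :: "(real, 'n) vec \<Rightarrow> real"
    and Lf \<mu> \<rho> :: real
    and x0 l0 :: "(real, 'n) vec"
    and m x y l :: "nat \<Rightarrow> (real, 'n) vec"
  assumes A_def: "A = {a. \<forall>i. a $ i \<in> As i}"
    and As_finite: "\<And>i. finite (As i)"
    and f_diff: "\<And>z. f differentiable (at z)"
    and f_lip: "Lf-lipschitz_on UNIV (gradient f)"
    and mu_nonneg: "0 \<le> \<mu>"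
    and f_weakly_convex: "convex_on UNIV (\<lambda>z. f z + \<mu> / 2 * (norm z)\<^sup>2)"
    and rho_pos: "0 < \<rho>"
    and rho_large: "inverse \<rho> * Lf\<^sup>2 - (\<rho> - \<mu>) / 2 < 0"
    and m_values: "\<And>r i. m r $ i \<in> {0, 1}"
    and run: "admm_r_run f A \<rho> x0 l0 m x y l"
begin

abbreviation "shifted r \<equiv> x r + inverse \<rho> *\<^sub>R l r"

lemma grad: "GDERIV f z :> gradient f z"
  by (rule GDERIV_gradient) (rule f_diff)

lemma Lf_nonneg: "0 \<le> Lf"
  using f_lip lipschitz_on_nonneg by blast

lemma A_finite: "finite A"
  unfolding A_def by (rule finite_vec_box) (rule As_finite)

lemma y_0: "y 0 \<in> A"
  using run by (simp add: admm_r_run_def)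

lemma y_step: "y (Suc r) $ i
    = m r $ i * projection A (shifted r) $ i + (1 - m r $ i) * y r $ i"
  using run by (simp add: admm_r_run_def)

lemma l_step: "l (Suc r) = l r + \<rho> *\<^sub>R (x (Suc r) - y (Suc r))"
  using run by (simp add: admm_r_run_def)

lemma projection_nearest: "projection A z \<in> nearest_points A z"
  using projection_in_nearest_points[OF A_finite] y_0 by blast

text \<open>A 0/1 mask selects each coordinate from one of two points of \<open>A\<close>, and a
  product set is closed under such mixing. Hence the indicator term vanishes along the run.\<close>

lemma y_in_A: "y r \<in> A"
proof (induction r)
  case 0
  show ?case by (rule y_0)
next
  case (Suc r)
  have "projection A (shifted r) \<in> A"
    using projection_nearest[of "shifted r"] by (simp add: nearest_points_def is_arg_min_def)
  then have "y (Suc r) $ i \<in> As i" for i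
    using Suc m_values[of r i] by (auto simp: A_def y_step)
  then show ?case by (simp add: A_def)
qed

lemma projection_component_le:
  assumes "c \<in> As i"
  shows "(z $ i - projection A z $ i)\<^sup>2 \<le> (z $ i - c)\<^sup>2"
  by (rule nearest_points_box_component[OF A_def projection_nearest assms])

lemma x_step: "lagrangian f \<rho> (x (Suc r)) (y (Suc r)) (l r) \<le> lagrangian f \<rho> z (y (Suc r)) (l r)"
proof -
  have "is_arg_min (\<lambda>z. aug_lagrangian f A \<rho> z (y (Suc r)) (l r)) (\<lambda>_. True) (x (Suc r))"
    using run by (simp add: admm_r_run_def)
  then have "aug_lagrangian f A \<rho> (x (Suc r)) (y (Suc r)) (l r)
      \<le> aug_lagrangian f A \<rho> z (y (Suc r)) (l r)"
    by (simp add: is_arg_min_linorder)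
  then show ?thesis
    by (simp add: aug_lagrangian_eq y_in_A)
qed

text \<open>First-order optimality of the \<open>x\<close>-step, combined with the multiplier
  update.\<close>

lemma multiplier: "l (Suc r) = - gradient f (x (Suc r))"
proof -
  let ?u = "x (Suc r)" and ?y = "y (Suc r)"
  \<comment> \<open>The gradient in \<open>x\<close> of the Lagrangian at the new iterate; by
    \<open>l_step\<close> it equals \<open>gradient f ?u + l (Suc r)\<close>.\<close>
  define D where "D = gradient f ?u + l r + \<rho> *\<^sub>R (?u - ?y)"
  have fd: "(f has_derivative (\<lambda>h. h \<bullet> gradient f ?u)) (at ?u)"
    using grad by (simp add: gderiv_def)
  have "((\<lambda>z. lagrangian f \<rho> z ?y (l r)) has_derivative (\<lambda>h. h \<bullet> D)) (at ?u)"
    unfolding lagrangian_def power2_norm_eq_inner D_def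
    by (auto intro!: derivative_eq_intros fd simp: inner_simps inner_commute algebra_simps)
  then have "(\<lambda>h. h \<bullet> D) = (\<lambda>h. 0)"
    using x_step by (rule_tac has_derivative_local_min) auto
  then have "D = 0"
    by (metis inner_eq_zero_iff)
  then show ?thesis
    by (simp add: l_step D_def algebra_simps eq_neg_iff_add_eq_0)
qed

lemma multiplier_diff:
  "norm (l (Suc (Suc r)) - l (Suc r)) \<le> Lf * norm (x (Suc (Suc r)) - x (Suc r))"
  using lipschitz_onD[OF f_lip, of "x (Suc (Suc r))" "x (Suc r)"]
  by (simp add: multiplier dist_norm norm_minus_commute)

text \<open>The penalty contributes curvature \<open>\<rho>\<close> and \<open>f\<close> loses at
  most \<open>\<mu>\<close>, so the \<open>x\<close>-subproblem is strongly convex with modulus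
  \<open>\<rho> - \<mu>\<close>.\<close>

lemma x_step_growth:
  "lagrangian f \<rho> (x (Suc r)) (y (Suc r)) (l r) + (\<rho> - \<mu>) / 2 * (norm (z - x (Suc r)))\<^sup>2
    \<le> lagrangian f \<rho> z (y (Suc r)) (l r)"
proof (rule strongly_convex_growth_at_minimum[where g = "\<lambda>z. lagrangian f \<rho> z (y (Suc r)) (l r)"])
  let ?y = "y (Suc r)"
  have "(\<lambda>z. lagrangian f \<rho> z ?y (l r) - (\<rho> - \<mu>) / 2 * (norm z)\<^sup>2)
    = (\<lambda>z. (f z + \<mu> / 2 * (norm z)\<^sup>2)
        + ((l r - \<rho> *\<^sub>R ?y) \<bullet> z + (\<rho> / 2 * (norm ?y)\<^sup>2 - l r \<bullet> ?y)))"
    by (rule ext)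
      (simp add: lagrangian_def power2_norm_eq_inner inner_simps inner_commute field_simps)
  moreover have "convex_on UNIV (\<lambda>z. (l r - \<rho> *\<^sub>R ?y) \<bullet> z + (\<rho> / 2 * (norm ?y)\<^sup>2 - l r \<bullet> ?y))"
    by (rule convex_on_inner_add_const)
  ultimately show "convex_on UNIV (\<lambda>z. lagrangian f \<rho> z ?y (l r) - (\<rho> - \<mu>) / 2 * (norm z)\<^sup>2)"
    using f_weakly_convex by (simp add: convex_on_add)
qed (rule x_step)

text \<open>Each coordinate of \<open>y\<close> is either kept or moved to a nearest point of
  \<open>As i\<close>, so no term of the squared distance to \<open>shifted r\<close> grows,
  whatever the mask.\<close>

lemma y_step_descent: "lagrangian f \<rho> (x r) (y (Suc r)) (l r) \<le> lagrangian f \<rho> (x r) (y r) (l r)"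
proof -
  have "(shifted r $ i - y (Suc r) $ i)\<^sup>2 \<le> (shifted r $ i - y r $ i)\<^sup>2" for i
    using m_values[of r i] projection_component_le[of "y r $ i" i "shifted r"] y_in_A[of r]
    by (auto simp: y_step A_def)
  then have "(norm (shifted r - y (Suc r)))\<^sup>2 \<le> (norm (shifted r - y r))\<^sup>2"
    unfolding norm_vec_sq by (intro sum_mono) simp
  then show ?thesis
    using rho_pos by (simp add: lagrangian_completed_square)
qed

text \<open>Gain of the \<open>x\<close>-step minus the ascent bound for the multiplier update, both
  per unit of squared \<open>x\<close>-increment.\<close>

definition "decrease_rate = (\<rho> - \<mu>) / 2 - inverse \<rho> * Lf\<^sup>2"

lemma decrease_rate_pos: "0 < decrease_rate"
  using rho_large by (simp add: decrease_rate_def)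

text \<open>Indexed from iterate 1 on: the initial multiplier is arbitrary, so \<open>\<lambda> = - \<nabla>f(x)\<close> fails at 0.\<close>

definition "lag r = lagrangian f \<rho> (x (Suc r)) (y (Suc r)) (l (Suc r))"

text \<open>One iteration is split into its \<open>y\<close>-, \<open>x\<close>- and multiplier
  updates, and the three changes of the Lagrangian are added.\<close>

lemma lag_descent: "lag (Suc r) + decrease_rate * (norm (x (Suc (Suc r)) - x (Suc r)))\<^sup>2 \<le> lag r"
proof -
  let ?x = "x (Suc r)" and ?x' = "x (Suc (Suc r))"
  let ?y' = "y (Suc (Suc r))" and ?l = "l (Suc r)" and ?l' = "l (Suc (Suc r))"
  have "lag (Suc r) = lagrangian f \<rho> ?x' ?y' ?l + (?l' - ?l) \<bullet> (?x' - ?y')"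
    by (simp add: lag_def lagrangian_def inner_diff_left)
  also have "(?l' - ?l) \<bullet> (?x' - ?y') = inverse \<rho> * (norm (?l' - ?l))\<^sup>2"
    unfolding power2_norm_eq_inner using rho_pos by (simp add: l_step[of "Suc r"])
  also have "\<dots> \<le> inverse \<rho> * (Lf * norm (?x' - ?x))\<^sup>2"
    using rho_pos multiplier_diff[of r] by (intro mult_left_mono power_mono) auto
  finally have "lag (Suc r)
      \<le> lagrangian f \<rho> ?x' ?y' ?l + inverse \<rho> * Lf\<^sup>2 * (norm (?x' - ?x))\<^sup>2"
    by (simp add: power_mult_distrib)
  moreover have "lagrangian f \<rho> ?x' ?y' ?l + (\<rho> - \<mu>) / 2 * (norm (?x' - ?x))\<^sup>2
      \<le> lagrangian f \<rho> ?x ?y' ?l"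
    using x_step_growth[of "Suc r" ?x] by (simp add: norm_minus_commute)
  moreover have "lagrangian f \<rho> ?x ?y' ?l \<le> lag r"
    using y_step_descent[of "Suc r"] by (simp add: lag_def)
  ultimately show ?thesis
    by (simp add: decrease_rate_def algebra_simps)
qed

text \<open>The parameter condition bounds \<open>inverse \<rho> * Lf\<^sup>2\<close> by
  \<open>(\<rho> - \<mu>) / 2\<close>, which is below \<open>\<rho>\<close>.\<close>

lemma Lf_le_rho: "Lf \<le> \<rho>"
proof -
  have "inverse \<rho> * Lf\<^sup>2 < \<rho>"
    using rho_large rho_pos mu_nonneg by simp
  then have "Lf\<^sup>2 < \<rho>\<^sup>2"
    using rho_pos by (simp add: field_simps power2_eq_square)
  then show ?thesis
    using rho_pos power_less_imp_less_base[of Lf 2 \<rho>] by simp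
qed

text \<open>By \<open>multiplier\<close>, \<open>lag r\<close> is the quadratic model of
  \<open>f\<close> around \<open>x (Suc r)\<close>, with curvature \<open>\<rho>\<close>, evaluated
  at \<open>y (Suc r)\<close>; it dominates \<open>f\<close> there because
  \<open>Lf \<le> \<rho>\<close>.\<close>

lemma lag_lower_bound: "Min (f ` A) \<le> lag r"
proof -
  let ?x = "x (Suc r)" and ?y = "y (Suc r)"
  have "Min (f ` A) \<le> f ?y"
    using A_finite y_in_A by simp
  also have "\<dots> \<le> f ?x + gradient f ?x \<bullet> (?y - ?x) + Lf / 2 * (norm (?y - ?x))\<^sup>2"
    by (rule lipschitz_gradient_upper_bound[OF grad f_lip])
  also have "\<dots> \<le> f ?x + gradient f ?x \<bullet> (?y - ?x) + \<rho> / 2 * (norm (?y - ?x))\<^sup>2"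
    using Lf_le_rho by (intro add_left_mono mult_right_mono) auto
  also have "\<dots> = lag r"
    by (simp add: lag_def lagrangian_def multiplier norm_minus_commute inner_diff_right)
  finally show ?thesis .
qed

text \<open>\<open>lag\<close> decreases and is bounded below, so it converges; its vanishing
  decrements dominate the squared increments.\<close>

lemma x_diff_tendsto: "(\<lambda>r. x (Suc r) - x r) \<longlonglongrightarrow> 0"
proof -
  have "lag (Suc r) \<le> lag r" for r
    using lag_descent[of r] decrease_rate_pos
    by (smt (verit, best) mult_nonneg_nonneg zero_le_power2)
  then have "decseq lag"
    by (rule decseq_SucI)
  then obtain c where c: "lag \<longlonglongrightarrow> c"
    using decseq_convergent[of lag] lag_lower_bound by metis
  have "(\<lambda>r. (lag r - lag (Suc r)) / decrease_rate) \<longlonglongrightarrow> (c - c) / decrease_rate"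
    using c decrease_rate_pos by (intro tendsto_intros LIMSEQ_Suc) auto
  then have "(\<lambda>r. (lag r - lag (Suc r)) / decrease_rate) \<longlonglongrightarrow> 0"
    by simp
  moreover have "(norm (x (Suc (Suc r)) - x (Suc r)))\<^sup>2 \<le> (lag r - lag (Suc r)) / decrease_rate" for r
    using lag_descent[of r] decrease_rate_pos by (simp add: field_simps)
  ultimately have "(\<lambda>r. (norm (x (Suc (Suc r)) - x (Suc r)))\<^sup>2) \<longlonglongrightarrow> 0"
    by (rule_tac tendsto_sandwich[OF _ _ tendsto_const]) auto
  then have "(\<lambda>r. sqrt ((norm (x (Suc (Suc r)) - x (Suc r)))\<^sup>2)) \<longlonglongrightarrow> sqrt 0"
    by (rule tendsto_real_sqrt)
  then have "(\<lambda>r. x (Suc (Suc r)) - x (Suc r)) \<longlonglongrightarrow> 0"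
    by (simp add: tendsto_norm_zero_iff)
  then show ?thesis
    by (rule LIMSEQ_imp_Suc)
qed

text \<open>The gap is the multiplier increment divided by \<open>\<rho>\<close>, hence controlled
  by the \<open>x\<close>-increment. Both shifts of the index come from
  \<open>multiplier_diff\<close>, which starts at iterate 1.\<close>

lemma x_minus_y_tendsto: "(\<lambda>r. x r - y r) \<longlonglongrightarrow> 0"
proof -
  have "norm (x (Suc (Suc r)) - y (Suc (Suc r))) \<le> inverse \<rho> * Lf * norm (x (Suc (Suc r)) - x (Suc r))" for r
  proof -
    have "norm (\<rho> *\<^sub>R (x (Suc (Suc r)) - y (Suc (Suc r)))) \<le> Lf * norm (x (Suc (Suc r)) - x (Suc r))"
      using multiplier_diff[of r] by (simp only: l_step[of "Suc r"] add_diff_cancel_left')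
    then have "\<rho> * norm (x (Suc (Suc r)) - y (Suc (Suc r))) \<le> Lf * norm (x (Suc (Suc r)) - x (Suc r))"
      using rho_pos by simp
    then show ?thesis
      using rho_pos by (simp add: field_simps)
  qed
  moreover have "(\<lambda>r. inverse \<rho> * Lf * norm (x (Suc (Suc r)) - x (Suc r))) \<longlonglongrightarrow> 0"
    using LIMSEQ_Suc[OF x_diff_tendsto] by (intro tendsto_mult_right_zero tendsto_norm_zero)
  ultimately have "(\<lambda>r. x (Suc (Suc r)) - y (Suc (Suc r))) \<longlonglongrightarrow> 0"
    by (rule Lim_null_comparison[OF always_eventually[OF allI]])
  then show ?thesis
    by (rule LIMSEQ_imp_Suc[OF LIMSEQ_imp_Suc])
qed

text \<open>The increments of \<open>y\<close> tend to 0, while distinct points of the finite set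
  \<open>A\<close> are at least some \<open>e > 0\<close> apart.\<close>

lemma y_eventually_const: "\<exists>c\<in>A. \<forall>\<^sub>F r in sequentially. y r = c"
proof -
  have "(\<lambda>r. (x (Suc r) - x r) - (x (Suc r) - y (Suc r)) + (x r - y r)) \<longlonglongrightarrow> 0 - 0 + 0"
    by (intro tendsto_intros x_diff_tendsto x_minus_y_tendsto LIMSEQ_Suc[OF x_minus_y_tendsto])
  then have y: "(\<lambda>r. y (Suc r) - y r) \<longlonglongrightarrow> 0"
    by simp
  obtain e where e: "e > 0" "\<And>a b. a \<in> A \<Longrightarrow> b \<in> A \<Longrightarrow> dist a b < e \<Longrightarrow> a = b"
    using A_finite uniform_discrete_finite_iff[of A]
    unfolding uniform_discrete_def by metis
  obtain N where N: "\<And>r. r \<ge> N \<Longrightarrow> norm (y (Suc r) - y r) < e"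
    using LIMSEQ_D[OF y e(1)] by auto
  have "y r = y N" if "r \<ge> N" for r
    using that
  proof (induction r rule: dec_induct)
    case (step r)
    then show ?case
      using e(2)[OF y_in_A y_in_A] N by (metis dist_norm)
  qed simp
  then show ?thesis
    using y_in_A by (auto simp: eventually_sequentially)
qed

text \<open>The whole sequence \<open>x\<close> converges to the final value \<open>c\<close> of
  \<open>y\<close>, so \<open>c\<close> is the only candidate for \<open>xbar\<close>; its
  stationarity is checked coordinate by coordinate.\<close>

lemma limit_point_stationary:
  assumes often: "\<And>i. infinite {r. m r $ i = 1}"
    and lim: "seq_limit_point (\<lambda>r. (x r, y r, l r)) (xbar, ybar, lbar)"
  shows "rho_stationary \<rho> f A xbar"
proof -
  obtain c where c: "c \<in> A" and y: "\<forall>\<^sub>F r in sequentially. y r = c"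
    using y_eventually_const by blast
  have "y \<longlonglongrightarrow> c"
    using y by (rule tendsto_eventually)
  then have x: "x \<longlonglongrightarrow> c"
    using tendsto_add[OF x_minus_y_tendsto, of y c] by simp
  have "isCont (gradient f) c"
    using lipschitz_on_continuous_on[OF f_lip] by (simp add: continuous_on_eq_continuous_at)
  then have "(\<lambda>r. - gradient f (x (Suc r))) \<longlonglongrightarrow> - gradient f c"
    by (rule tendsto_minus[OF isCont_tendsto_compose[OF _ LIMSEQ_Suc[OF x]]])
  then have "l \<longlonglongrightarrow> - gradient f c"
    unfolding multiplier[symmetric] by (rule LIMSEQ_imp_Suc)
  from tendsto_add[OF x tendsto_scaleR[OF tendsto_const this]]
  have "shifted \<longlonglongrightarrow> c + inverse \<rho> *\<^sub>R (- gradient f c)" .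
  \<comment> \<open>The gradient-step point in the definition of \<open>rho_stationary\<close> at
    \<open>c\<close>; the projected points \<open>shifted r\<close> converge to it.\<close>
  define z where "z = c - inverse \<rho> *\<^sub>R gradient f c"
  have shifted: "shifted \<longlonglongrightarrow> z"
    using \<open>shifted \<longlonglongrightarrow> _\<close> by (simp add: z_def)
  have comp: "(z $ i - c $ i)\<^sup>2 \<le> (z $ i - a)\<^sup>2" if a: "a \<in> As i" for i a
  proof (rule ccontr)
    assume "\<not> ?thesis"
    then have less: "(z $ i - a)\<^sup>2 < (z $ i - c $ i)\<^sup>2"
      by simp
    have "(\<lambda>r. (shifted r $ i - c $ i)\<^sup>2 - (shifted r $ i - a)\<^sup>2)
        \<longlonglongrightarrow> (z $ i - c $ i)\<^sup>2 - (z $ i - a)\<^sup>2"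
      by (intro tendsto_intros shifted)
    then have "\<forall>\<^sub>F r in sequentially. 0 < (shifted r $ i - c $ i)\<^sup>2 - (shifted r $ i - a)\<^sup>2"
      by (rule order_tendstoD) (use less in simp)
    moreover have "\<forall>\<^sub>F r in sequentially. y (Suc r) = c"
      by (rule eventually_sequentially_Suc[of "\<lambda>r. y r = c", THEN iffD2, OF y])
    \<comment> \<open>If some \<open>a\<close> were strictly nearer to \<open>z $ i\<close> than
      \<open>c $ i\<close>, a late refresh of coordinate \<open>i\<close> would have to move it away
      from \<open>c $ i\<close>, yet \<open>y\<close> no longer changes.\<close>
    ultimately have "\<forall>\<^sub>F r in sequentially. m r $ i \<noteq> 1"
    proof eventually_elim
      case (elim r)
      show ?case
      proof
        assume "m r $ i = 1"
        then have "projection A (shifted r) $ i = c $ i"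
          using y_step[of r i] elim(2) by simp
        then show False
          using projection_component_le[OF a, of "shifted r"] elim(1) by simp
      qed
    qed
    then have "finite {r. m r $ i = 1}"
      unfolding cofinite_eq_sequentially[symmetric] eventually_cofinite by simp
    with often show False
      by blast
  qed
  have "norm (c - z) \<le> norm (a - z)" if "a \<in> A" for a
  proof -
    have "(norm (z - c))\<^sup>2 \<le> (norm (z - a))\<^sup>2"
      unfolding norm_vec_sq using comp that by (intro sum_mono) (simp add: A_def)
    then show ?thesis
      by (simp add: norm_minus_commute)
  qed
  then have "rho_stationary \<rho> f A c"
    using c by (simp add: rho_stationary_def is_arg_min_linorder z_def)
  moreover have "xbar = c"
  proof -
    obtain s where s: "strict_mono s" "((\<lambda>r. (x r, y r, l r)) \<circ> s) \<longlonglongrightarrow> (xbar, ybar, lbar)"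
      using lim unfolding seq_limit_point_def by blast
    from tendsto_fst[OF s(2)] have "(x \<circ> s) \<longlonglongrightarrow> xbar"
      by (simp add: o_def)
    moreover have "(x \<circ> s) \<longlonglongrightarrow> c"
      by (rule LIMSEQ_subseq_LIMSEQ[OF x s(1)])
    ultimately show ?thesis
      by (rule LIMSEQ_unique)
  qed
  ultimately show ?thesis by simp
qed

end

section \<open>Almost sure recurrence of the refreshes\<close>

text \<open>Continuity from above gives the limsup event probability at least
  \<open>\<alpha>\<close>; the Borel 0-1 law then leaves only the value 1.\<close>

lemma (in prob_space) AE_infinitely_often:
  fixes P :: "nat \<Rightarrow> 'a \<Rightarrow> bool"
  assumes indep: "indep_events (\<lambda>r. {w \<in> space M. P r w}) UNIV"
    and "0 < \<alpha>" and prob: "\<And>r. \<alpha> \<le> prob {w \<in> space M. P r w}"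
  shows "AE w in M. infinite {r. P r w}"
proof -
  let ?E = "\<lambda>r. {w \<in> space M. P r w}"
  let ?U = "\<lambda>n. \<Union>r\<in>{n..}. ?E r"
  have meas [measurable]: "?E r \<in> events" for r
    using indep by (auto simp: indep_events_def)
  have "\<alpha> \<le> prob (?U n)" for n
    using prob[of n] by (rule order_trans) (intro finite_measure_mono; auto)
  moreover have "(\<lambda>n. prob (?U n)) \<longlonglongrightarrow> prob (\<Inter>n. ?U n)"
    by (intro finite_Lim_measure_decseq decseq_SucI UN_mono) auto
  ultimately have "\<alpha> \<le> prob (\<Inter>n. ?U n)"
    using LIMSEQ_le_const by blast
  then have "prob (\<Inter>n. ?U n) \<noteq> 0"
    using \<open>0 < \<alpha>\<close> by simp
  then have "prob (\<Inter>n. ?U n) = 1"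
    using borel_0_1_law[OF indep] by blast
  then have "AE w in M. w \<in> (\<Inter>n. ?U n)"
    by (subst (asm) prob_eq_1) auto
  then show ?thesis
    by (rule AE_mp) (auto simp: infinite_nat_iff_unbounded_le)
qed

theorem theorem5p1:
  fixes M :: "'w measure"
    and As :: "'n::{finite, linorder} \<Rightarrow> real set"
    and A :: "(real, 'n) vec set"
    and f :: "(real, 'n) vec \<Rightarrow> real"
    and Lf \<mu> \<rho> \<alpha> :: real
    and p :: "nat \<Rightarrow> 'n \<Rightarrow> real"
    and m :: "nat \<Rightarrow> 'w \<Rightarrow> (real, 'n) vec"
    and x0 l0 :: "(real, 'n) vec"
    and x y l :: "nat \<Rightarrow> 'w \<Rightarrow> (real, 'n) vec"
  assumes A_def: "A = {a. \<forall>i. a $ i \<in> As i}"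
    and As_finite: "\<And>i. finite (As i)"
    and As_nonempty: "\<And>i. As i \<noteq> {}"
    and f_min: "- \<infinity> < Min ((\<lambda>a. ereal (f a)) ` A)"
    and f_diff: "\<And>z. f differentiable (at z)"
    and f_lip: "Lf-lipschitz_on UNIV (gradient f)"
    and mu_nonneg: "0 \<le> \<mu>"
    and f_weakly_convex: "convex_on UNIV (\<lambda>z. f z + \<mu> / 2 * (norm z)\<^sup>2)"
    and rho_pos: "0 < \<rho>"
    and rho_large: "inverse \<rho> * Lf\<^sup>2 - (\<rho> - \<mu>) / 2 < 0"
    and M_prob: "prob_space M"
    and alpha_pos: "0 < \<alpha>"
    and p_bounds: "\<And>r i. \<alpha> \<le> p r i \<and> p r i \<le> 1"
    and m_values: "\<And>r i w. w \<in> space M \<Longrightarrow> m r w $ i \<in> {0, 1}"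
    and m_prob: "\<And>r i. measure M {w \<in> space M. m r w $ i = 1} = p r i"
    and m_indep: "prob_space.indep_vars M (\<lambda>_. borel) m UNIV"
    and run: "\<And>w. w \<in> space M \<Longrightarrow>
      admm_r_run f A \<rho> x0 l0 (\<lambda>r. m r w) (\<lambda>r. x r w) (\<lambda>r. y r w) (\<lambda>r. l r w)"
  shows "AE w in M. \<forall>xbar ybar lbar.
    seq_limit_point (\<lambda>r. (x r w, y r w, l r w)) (xbar, ybar, lbar) \<longrightarrow>
    rho_stationary \<rho> f A xbar"
proof -
  interpret prob_space M by (rule M_prob)
  \<comment> \<open>For a fixed coordinate, these events are independent across iterations, however
    the coordinates of a single mask are correlated.\<close>
  have "AE w in M. infinite {r. m r w $ i = 1}" for i
  proof (rule AE_infinitely_often[OF _ alpha_pos])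
    \<comment> \<open>Provides the Borel measurability needed to pass from independent vectors to
      independent events.\<close>
    have "closed {v :: (real, 'n) vec. v $ i = 1}"
      by (intro closed_Collect_eq continuous_intros)
    then show "indep_events (\<lambda>r. {w \<in> space M. m r w $ i = 1}) UNIV"
      using indep_eventsI_indep_vars[OF m_indep, of "\<lambda>r v. v $ i = 1"] by simp
    show "\<alpha> \<le> prob {w \<in> space M. m r w $ i = 1}" for r
      using p_bounds by (simp add: m_prob)
  qed
  then have "AE w in M. \<forall>i. infinite {r. m r w $ i = 1}"
    by (simp add: AE_all_countable)
  then show ?thesis
  proof (rule AE_mp, intro AE_I2 impI allI)
    fix w xbar ybar lbar
    assume w: "w \<in> space M" and often: "\<forall>i. infinite {r. m r w $ i = 1}"
      and lim: "seq_limit_point (\<lambda>r. (x r w, y r w, l r w)) (xbar, ybar, lbar)"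
    \<comment> \<open>The deterministic analysis is applied to each realisation \<open>w\<close>
      separately.\<close>
    interpret admm_r As A f Lf \<mu> \<rho> x0 l0 "\<lambda>r. m r w" "\<lambda>r. x r w" "\<lambda>r. y r w" "\<lambda>r. l r w"
      by unfold_locales
        (use A_def As_finite f_diff f_lip mu_nonneg f_weakly_convex rho_pos rho_large
          m_values[OF w] run[OF w] in auto)
    show "rho_stationary \<rho> f A xbar"
      using limit_point_stationary often lim by blast
  qed
qed

end
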